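(* Let $Q$ be a finite-dimensional real vector space with dual $Q^*$, let $T>0$, let $H:[0,T]\times Q\times Q^*\to\mathbb{R}$ be a smooth function, and fix $q_0\in Q$ and $p_1\in Q^*$. Let $(q,p)\in C^1_{q_0}([0,T],Q\times Q^* )$, i.e. $(q,p):[0,T]\to Q\times Q^*$ is a $C^1$ curve with $q(0)=q_0$. Then the Type II d'Alembert variational principle $$\delta S[q,p]=\langle p_1,\delta q(T)\rangle\quad\text{for all partial variations }(\delta q,\delta p)\text{ of }(q,p)$$ holds if and only if Hamilton's equations with Type II boundary conditions hold: $$\dot q(t)=D_pH(t,q(t),p(t)),\qquad \dot p(t)=-D_qH(t,q(t),p(t))\qquad\text{for all }t\in(0,T),$$ $$q(0)=q_0,\qquad p(T)=p_1.$$
   Context: $\langle\cdot,\cdot\rangle:Q^*\times Q\to\mathbb{R}$ is the duality pairing, and $T^*Q$ is identified with $Q\times Q^*$. No regularity (non-degeneracy) of $H$ in $p$ is assumed. $D_qH\in Q^*$ and $D_pH\in Q$ denote the partial derivatives of $H$. The space of curves is $C^1_{q_0}([0,T],Q\times Q^* )=\{(q,p)\in C^1([0,T],Q\times Q^* ):q(0)=q_0\}$. The action $S:C^1_{q_0}([0,T],Q\times Q^* )\to\mathbb{R}$ is $$S[q,p]=\int_0^T\big[\langle p(t),\dot q(t)\rangle-H(t,q(t),p(t))\big]\,dt.$$ A partial variation of $(q,p)$ is a tangent vector to this space of curves at $(q,p)$, i.e. a $C^1$ map $(\delta q,\delta p)$ with $(\delta q(t),\delta p(t))\in T_{(q(t),p(t))}(Q\times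 Q^* )\cong Q\times Q^*$ for all $t\in[0,T]$ and $\delta q(0)=0$ (no condition on $\delta q(T)$ or on $\delta p$). The variation of the action is $\delta S[q,p]=\frac{d}{d\epsilon}\big|_{\epsilon=0}S[q_\epsilon,p_\epsilon]$, where $(q_\epsilon,p_\epsilon)$ is a one-parameter family of curves in $C^1_{q_0}([0,T],Q\times Q^* )$ with $(q_{\epsilon},p_{\epsilon})|_{\epsilon=0}=(q,p)$ and $\frac{d}{d\epsilon}|_{\epsilon=0}(q_\epsilon,p_\epsilon)=(\delta q,\delta p)$ (for example $(q+\epsilon\,\delta q,\,p+\epsilon\,\delta p)$). *)

theory Defs
  imports "HOL-Analysis.Analysis"
begin

type_synonym 'q dual = "'q \<Rightarrow>\<^sub>L real"

text \<open>
  The space \<open>Q\<close> is the universe of a normed type \<open>'q\<close>. The norm only supplies the topology: in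
  finite dimension all norms are equivalent, and every linear functional is bounded, so that
  \<open>'q dual\<close> is the full algebraic dual.
\<close>

definition finite_dimensional :: "'q::real_normed_vector itself \<Rightarrow> bool" where
  "finite_dimensional _ \<longleftrightarrow> (\<exists>B :: 'q set. finite B \<and> span B = UNIV)"

text \<open>
  Derivatives are taken within \<open>S\<close>, hence one-sided at the ends of a closed time interval; values
  outside \<open>S\<close> are irrelevant. Continuity of the derivative is required direction by direction,
  which for a finite-dimensional domain is continuity in the operator norm. The sets used here
  are intervals of positive length and their products with whole spaces; on these the derivative
  within the set is unique.
\<close>

primrec Ck_on :: "nat \<Rightarrow> 'a::real_normed_vector set \<Rightarrow> ('a \<Rightarrow> 'b::real_normed_vector) \<Rightarrow> bool" where
  "Ck_on 0 S f \<longleftrightarrow> continuous_on S f"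
| "Ck_on (Suc k) S f \<longleftrightarrow>
     (\<exists>f'. (\<forall>x\<in>S. (f has_derivative f' x) (at x within S)) \<and> (\<forall>v. Ck_on k S (\<lambda>x. f' x v)))"

definition smooth_on :: "'a::real_normed_vector set \<Rightarrow> ('a \<Rightarrow> 'b::real_normed_vector) \<Rightarrow> bool" where
  "smooth_on S f \<longleftrightarrow> (\<forall>k. Ck_on k S f)"

definition D_q :: "(real \<times> 'q::real_normed_vector \<times> 'q dual \<Rightarrow> real) \<Rightarrow> real \<Rightarrow> 'q \<Rightarrow> 'q dual \<Rightarrow> 'q dual" where
  "D_q H t q p = Blinfun (frechet_derivative (\<lambda>x. H (t, x, p)) (at q))"

text \<open>
  The partial derivative in \<open>p\<close> is an element of the bidual; it is identified with the vector
  of \<open>Q\<close> at which it evaluates functionals.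
\<close>

definition D_p :: "(real \<times> 'q::real_normed_vector \<times> 'q dual \<Rightarrow> real) \<Rightarrow> real \<Rightarrow> 'q \<Rightarrow> 'q dual \<Rightarrow> 'q" where
  "D_p H t q p =
     (THE v. frechet_derivative (\<lambda>y. H (t, q, y)) (at p) = (\<lambda>\<alpha>. blinfun_apply \<alpha> v))"

definition C1_curves :: "real \<Rightarrow> 'q::real_normed_vector \<Rightarrow> ((real \<Rightarrow> 'q) \<times> (real \<Rightarrow> 'q dual)) set" where
  "C1_curves T q0 = {(q, p). Ck_on 1 {0..T} q \<and> Ck_on 1 {0..T} p \<and> q 0 = q0}"

abbreviation velocity :: "real \<Rightarrow> (real \<Rightarrow> 'a::real_normed_vector) \<Rightarrow> real \<Rightarrow> 'a" where
  "velocity T c t \<equiv> vector_derivative c (at t within {0..T})"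

definition action ::
  "(real \<times> 'q::real_normed_vector \<times> 'q dual \<Rightarrow> real) \<Rightarrow> real \<Rightarrow> (real \<Rightarrow> 'q) \<Rightarrow> (real \<Rightarrow> 'q dual) \<Rightarrow> real" where
  "action H T q p =
     integral {0..T} (\<lambda>t. blinfun_apply (p t) (velocity T q t) - H (t, q t, p t))"

text \<open>
  Since the target is a vector space, tangent vectors at different base points are identified, and
  the condition does not mention the curve being varied.
\<close>

definition partial_variation :: "real \<Rightarrow> (real \<Rightarrow> 'q::real_normed_vector) \<Rightarrow> (real \<Rightarrow> 'q dual) \<Rightarrow> bool" where
  "partial_variation T \<delta>q \<delta>p \<longleftrightarrow> Ck_on 1 {0..T} \<delta>q \<and> Ck_on 1 {0..T} \<delta>p \<and> \<delta>q 0 = 0"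

text \<open>
  The derivative at \<open>\<epsilon> = 0\<close> of a one-parameter family of curves is taken in the space of
  \<open>C\<^sup>1\<close> curves with its \<open>C\<^sup>1\<close> norm: the difference quotients and their time derivatives
  converge uniformly on \<open>[0,T]\<close>. Pointwise convergence alone would not make the action
  differentiable in \<open>\<epsilon>\<close>.
\<close>

definition C1_family_derivative ::
  "real \<Rightarrow> (real \<Rightarrow> real \<Rightarrow> 'a::real_normed_vector) \<Rightarrow> (real \<Rightarrow> 'a) \<Rightarrow> bool" where
  "C1_family_derivative T c \<delta>c \<longleftrightarrow>
     uniform_limit {0..T} (\<lambda>\<epsilon> t. (c \<epsilon> t - c 0 t) /\<^sub>R \<epsilon>) \<delta>c (at 0) \<and>
     uniform_limit {0..T} (\<lambda>\<epsilon> t. (velocity T (c \<epsilon>) t - velocity T (c 0) t) /\<^sub>R \<epsilon>)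
       (velocity T \<delta>c) (at 0)"

definition generates_variation ::
  "real \<Rightarrow> 'q::real_normed_vector \<Rightarrow> (real \<Rightarrow> 'q) \<Rightarrow> (real \<Rightarrow> 'q dual) \<Rightarrow>
   (real \<Rightarrow> real \<Rightarrow> 'q) \<Rightarrow> (real \<Rightarrow> real \<Rightarrow> 'q dual) \<Rightarrow>
   (real \<Rightarrow> 'q) \<Rightarrow> (real \<Rightarrow> 'q dual) \<Rightarrow> bool" where
  "generates_variation T q0 q p qf pf \<delta>q \<delta>p \<longleftrightarrow>
     (\<forall>\<^sub>F \<epsilon> in nhds 0. (qf \<epsilon>, pf \<epsilon>) \<in> C1_curves T q0) \<and>
     (\<forall>t\<in>{0..T}. qf 0 t = q t \<and> pf 0 t = p t) \<and>
     C1_family_derivative T qf \<delta>q \<and> C1_family_derivative T pf \<delta>p"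

text \<open>
  The variation of the action is required to exist and to have the value \<open>d\<close> for every family
  generating \<open>(\<delta>q, \<delta>p)\<close>; the straight-line family always is one.
\<close>

definition has_action_variation ::
  "(real \<times> 'q::real_normed_vector \<times> 'q dual \<Rightarrow> real) \<Rightarrow> real \<Rightarrow> 'q \<Rightarrow>
   (real \<Rightarrow> 'q) \<Rightarrow> (real \<Rightarrow> 'q dual) \<Rightarrow> (real \<Rightarrow> 'q) \<Rightarrow> (real \<Rightarrow> 'q dual) \<Rightarrow> real \<Rightarrow> bool" where
  "has_action_variation H T q0 q p \<delta>q \<delta>p d \<longleftrightarrow>
     (\<forall>qf pf. generates_variation T q0 q p qf pf \<delta>q \<delta>p \<longrightarrow>
        ((\<lambda>\<epsilon>. action H T (qf \<epsilon>) (pf \<epsilon>)) has_real_derivative d) (at 0))"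

definition typeII_dAlembert ::
  "(real \<times> 'q::real_normed_vector \<times> 'q dual \<Rightarrow> real) \<Rightarrow> real \<Rightarrow> 'q \<Rightarrow> 'q dual \<Rightarrow>
   (real \<Rightarrow> 'q) \<Rightarrow> (real \<Rightarrow> 'q dual) \<Rightarrow> bool" where
  "typeII_dAlembert H T q0 p1 q p \<longleftrightarrow>
     (\<forall>\<delta>q \<delta>p. partial_variation T \<delta>q \<delta>p \<longrightarrow>
        has_action_variation H T q0 q p \<delta>q \<delta>p (blinfun_apply p1 (\<delta>q T)))"

end

theory Submission
  imports Defs
begin

text \<open>
  Along any family generating \<open>(\<delta>q, \<delta>p)\<close>, the difference quotients of the integrand converge uniformly
  (mean value theorem and joint continuity of the derivative), so the action may be differentiated
  under the integral sign:
  \<open>\<delta>S = \<integral> \<langle>p, \<delta>q'\<rangle> - \<langle>D\<^sub>qH, \<delta>q\<rangle> + \<langle>\<delta>p, q' - D\<^sub>pH\<rangle> dt\<close>.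
  Since \<open>p\<close> is \<open>C\<^sup>1\<close> and \<open>\<delta>q(0) = 0\<close>, integration by parts turns this into
  \<open>\<langle>p(T), \<delta>q(T)\<rangle> + \<integral> \<langle>- p' - D\<^sub>qH, \<delta>q\<rangle> + \<langle>\<delta>p, q' - D\<^sub>pH\<rangle> dt\<close>. Hamilton's equations kill the integral.
  Conversely, testing with \<open>\<delta>p = h \<alpha>\<close> and \<open>\<delta>q = h v\<close> for scalar \<open>h\<close> with a free end point reduces the
  claim to the fundamental lemma, which delivers the equations and \<open>p(T) = p\<^sub>1\<close> together.
\<close>

section \<open>Coordinates on a finite-dimensional normed space and its dual\<close>

text \<open>Coordinates with respect to a basis are linear for algebraic reasons; the substance is
  that they are bounded for the given norm, so that they are elements of \<open>'q dual\<close>. The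
  expansion formula then serves wherever finite dimension matters.\<close>

lemma finite_dimensional_dual_basis:
  assumes "finite_dimensional TYPE('q::real_normed_vector)"
  obtains B :: "'q::real_normed_vector set" and \<phi> :: "'q \<Rightarrow> 'q dual"
  where "finite B" and "\<And>x. x = (\<Sum>b\<in>B. blinfun_apply (\<phi> b) x *\<^sub>R b)"
proof -
  obtain B0 :: "'q set" where B0: "finite B0" "span B0 = UNIV"
    using assms by (auto simp: finite_dimensional_def)
  obtain B where B: "B \<subseteq> B0" "independent B" "span B = UNIV"
    using maximal_independent_subset[of B0] B0 span_mono span_span top.extremum_uniqueI
    by metis
  have fin: "finite B" using B(1) B0(1) finite_subset by blast
  define r where "r x = representation B x" for x
  have expand: "(\<Sum>b\<in>B. r x b *\<^sub>R b) = x" for x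
    unfolding r_def using sum_representation_eq[of B x B] B fin by simp
  have r_lin: "linear (\<lambda>x. r x b)" for b
    unfolding r_def using linear_representation[OF B(2,3)]
    by (simp add: linear_def real_scaleR_def[abs_def])
  \<comment> \<open>On the unit sphere for the sum norm of the coordinates, which is compact in the product topology,
    the norm of the combination has a positive minimum; this bounds the coordinate functionals.\<close>
  define s where "s a = (\<Sum>b\<in>B. \<bar>a b\<bar>)" for a :: "'q \<Rightarrow> real"
  define K where "K = Pi\<^sub>E UNIV (\<lambda>b. if b \<in> B then {-1..1} else {0::real}) \<inter> s -` {1}"
  have cont_s: "continuous_on UNIV s"
    unfolding s_def by (intro continuous_intros continuous_on_product_coordinates)
  \<comment> \<open>This is Tychonoff's theorem on the space of all functions on \<open>'q\<close>:
    outside \<open>B\<close> the factor is the single point 0, so every factor is compact.\<close>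
  have "compactin (product_topology (\<lambda>i. euclidean) UNIV)
      (Pi\<^sub>E UNIV (\<lambda>b::'q. if b \<in> B then {-1..1} else {0::real}))"
    by (subst compactin_PiE) auto
  then have "compact (Pi\<^sub>E UNIV (\<lambda>b::'q. if b \<in> B then {-1..1} else {0::real}))"
    by (simp add: euclidean_product_topology)
  moreover have "closed (s -` {1})"
    using continuous_on_closed_vimage[of UNIV s] cont_s by simp
  ultimately have K: "compact K"
    unfolding K_def by (rule compact_Int_closed)
  define N where "N a = norm (\<Sum>b\<in>B. a b *\<^sub>R b)" for a :: "'q \<Rightarrow> real"
  have cont_N: "continuous_on K N"
    unfolding N_def by (intro continuous_intros continuous_on_subset[OF continuous_on_product_coordinates]) auto
  have pos: "N a > 0" if "a \<in> K" for a
  proof -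
    have "s a \<noteq> 0"
      using that by (simp add: K_def)
    then have "\<exists>b\<in>B. a b \<noteq> 0"
      unfolding s_def by (metis abs_zero sum.neutral)
    then have "(\<Sum>b\<in>B. a b *\<^sub>R b) \<noteq> 0"
      using B(2) fin by (auto simp: dependent_finite)
    then show ?thesis by (simp add: N_def)
  qed
  obtain m where m: "m > 0" "\<And>a. a \<in> K \<Longrightarrow> m \<le> N a"
  proof (cases "K = {}")
    \<comment> \<open>This happens only if \<open>B\<close> is empty, that is, on the zero space;
      any positive \<open>m\<close> will do.\<close>
    case True
    then show thesis using that[of 1] by simp
  next
    case False
    then show thesis
      using continuous_attains_inf[OF K False cont_N] pos that by blast
  qed
  have bound: "\<bar>r x b\<bar> \<le> norm x * (1 / m)" if "b \<in> B" for x b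
  proof (cases "s (r x) = 0")
    case True
    then show ?thesis using that fin m(1) by (auto simp: s_def sum_nonneg_eq_0_iff)
  next
    case False
    then have sp: "s (r x) > 0" unfolding s_def by (smt (verit) sum_nonneg)
    have le: "\<bar>r x b\<bar> \<le> s (r x)" if "b \<in> B" for b
      unfolding s_def using that fin by (intro member_le_sum) auto
    \<comment> \<open>The coordinates of \<open>x\<close> are rescaled onto the sphere. By
      homogeneity the bound \<open>m \<le> N ?a\<close> becomes
      \<open>m * s (r x) \<le> norm x\<close>, which controls each single coordinate.\<close>
    let ?a = "\<lambda>b. r x b / s (r x)"
    have "r x b = 0" if "b \<notin> B" for b
      using that representation_ne_zero unfolding r_def by blast
    moreover have "?a b \<in> {-1..1}" if "b \<in> B" for b
      using le[OF that] sp by (simp add: pos_le_divide_eq pos_divide_le_eq abs_le_iff)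
    ultimately have "?a \<in> Pi\<^sub>E UNIV (\<lambda>b. if b \<in> B then {-1..1} else {0::real})"
      by auto
    moreover have "s ?a = 1"
      using sp by (simp add: s_def abs_divide flip: sum_divide_distrib)
    ultimately have "m \<le> N ?a"
      by (intro m) (simp add: K_def)
    also have "N ?a = norm ((1 / s (r x)) *\<^sub>R (\<Sum>b\<in>B. r x b *\<^sub>R b))"
      unfolding N_def scaleR_sum_right by (simp add: divide_inverse mult.commute)
    also have "\<dots> = norm x / s (r x)"
      using sp by (simp add: expand)
    finally have "s (r x) \<le> norm x * (1 / m)"
      using sp m(1) by (simp add: field_simps)
    then show ?thesis using le[OF that] by linarith
  qed
  have bl: "bounded_linear (\<lambda>x. r x b)" if "b \<in> B" for b
    by (rule bounded_linear_intro[where K = "1 / m"])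
      (use bound[OF that] in \<open>simp_all add: linear_add[OF r_lin] linear_cmul[OF r_lin]\<close>)
  show thesis
  proof (rule that[OF fin, of "\<lambda>b. Blinfun (\<lambda>x. r x b)"])
    fix x
    have "(\<Sum>b\<in>B. blinfun_apply (Blinfun (\<lambda>x. r x b)) x *\<^sub>R b) = (\<Sum>b\<in>B. r x b *\<^sub>R b)"
      by (intro sum.cong) (simp_all add: bounded_linear_Blinfun_apply bl)
    then show "x = (\<Sum>b\<in>B. blinfun_apply (Blinfun (\<lambda>x. r x b)) x *\<^sub>R b)"
      unfolding expand by (rule sym)
  qed
qed

lemma dual_separates_points:
  fixes v w :: "'q::real_normed_vector"
  assumes "finite_dimensional TYPE('q)" and "\<And>\<alpha> :: 'q dual. blinfun_apply \<alpha> v = blinfun_apply \<alpha> w"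
  shows "v = w"
proof -
  obtain B :: "'q set" and \<phi> :: "'q \<Rightarrow> 'q dual" where
    B: "\<And>x. x = (\<Sum>b\<in>B. blinfun_apply (\<phi> b) x *\<^sub>R b)"
    using finite_dimensional_dual_basis[OF assms(1)] by blast
  have "v = (\<Sum>b\<in>B. blinfun_apply (\<phi> b) w *\<^sub>R b)"
    by (rule B[of v, unfolded assms(2)])
  also have "\<dots> = w"
    by (rule B[of w, symmetric])
  finally show ?thesis .
qed

text \<open>The functionals \<open>\<phi> b\<close> span the dual, since \<alpha> is the sum of its
  values on \<open>B\<close> times the \<open>\<phi> b\<close>. Hence \<Phi> is evaluation at the
  vector with coordinates \<open>\<Phi> (\<phi> b)\<close>. Unique existence is what gives the
  definite description in \<open>D_p\<close> its meaning.\<close>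

lemma bidual_represented:
  fixes \<Phi> :: "'q::real_normed_vector dual \<Rightarrow> real"
  assumes "finite_dimensional TYPE('q)" and "linear \<Phi>"
  shows "\<exists>!v. \<Phi> = (\<lambda>\<alpha>. blinfun_apply \<alpha> v)"
proof -
  obtain B :: "'q set" and \<phi> :: "'q \<Rightarrow> 'q dual" where
    B: "finite B" "\<And>x. x = (\<Sum>b\<in>B. blinfun_apply (\<phi> b) x *\<^sub>R b)"
    using finite_dimensional_dual_basis[OF assms(1)] by blast
  interpret linear \<Phi> by fact
  have rep: "\<Phi> \<alpha> = blinfun_apply \<alpha> (\<Sum>b\<in>B. \<Phi> (\<phi> b) *\<^sub>R b)" for \<alpha>
  proof -
    have "blinfun_apply \<alpha> x = blinfun_apply (\<Sum>b\<in>B. blinfun_apply \<alpha> b *\<^sub>R \<phi> b) x" for x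
    proof -
      have "blinfun_apply \<alpha> x = blinfun_apply \<alpha> (\<Sum>b\<in>B. blinfun_apply (\<phi> b) x *\<^sub>R b)"
        using B(2)[of x] by (rule arg_cong)
      then show ?thesis
        by (simp add: blinfun.sum_left blinfun.sum_right blinfun.scaleR_left blinfun.scaleR_right
            mult.commute)
    qed
    then have "\<alpha> = (\<Sum>b\<in>B. blinfun_apply \<alpha> b *\<^sub>R \<phi> b)"
      by (rule blinfun_eqI)
    from arg_cong[OF this, of \<Phi>] have "\<Phi> \<alpha> = \<Phi> (\<Sum>b\<in>B. blinfun_apply \<alpha> b *\<^sub>R \<phi> b)" by simp
    then show ?thesis
      by (simp add: sum scale blinfun.sum_right blinfun.scaleR_right mult.commute)
  qed
  show ?thesis
  proof (rule ex1I)
    show "\<Phi> = (\<lambda>\<alpha>. blinfun_apply \<alpha> (\<Sum>b\<in>B. \<Phi> (\<phi> b) *\<^sub>R b))"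
      using rep by blast
    show "v = (\<Sum>b\<in>B. \<Phi> (\<phi> b) *\<^sub>R b)" if "\<Phi> = (\<lambda>\<alpha>. blinfun_apply \<alpha> v)" for v
      using dual_separates_points[OF assms(1)] rep that by metis
  qed
qed

section \<open>Uniform limits\<close>

text \<open>\<open>F\<close> need not be uniformly continuous on \<open>A\<close>, but near the
  compact set \<open>K\<close> it behaves as if it were. Cover \<open>K\<close> by balls on which
  \<open>F\<close> stays within half of \<epsilon> of its value at the centre; a Lebesgue number
  \<open>r\<close> of this cover places \<open>g x\<close> and every \<open>f e x\<close> within
  \<open>r\<close> of it in one common ball.\<close>

lemma uniform_limit_compose_compact:
  fixes F :: "'a::metric_space \<Rightarrow> 'b::metric_space"
  assumes F: "continuous_on A F" and K: "compact K" "K \<subseteq> A" "g ` S \<subseteq> K"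
    and lim: "uniform_limit S f g \<F>" and ev: "\<forall>\<^sub>F e in \<F>. \<forall>x\<in>S. f e x \<in> A"
  shows "uniform_limit S (\<lambda>e x. F (f e x)) (\<lambda>x. F (g x)) \<F>"
proof (rule uniform_limitI)
  fix \<epsilon> :: real assume "\<epsilon> > 0"
  then have "\<forall>x\<in>K. \<exists>d>0. \<forall>y\<in>A. dist y x < d \<longrightarrow> dist (F y) (F x) < \<epsilon> / 2"
    using F K(2) unfolding continuous_on_iff by (meson half_gt_zero subsetD)
  then obtain d where d: "\<And>x. x \<in> K \<Longrightarrow> d x > 0"
    "\<And>x y. \<lbrakk>x \<in> K; y \<in> A; dist y x < d x\<rbrakk> \<Longrightarrow> dist (F y) (F x) < \<epsilon> / 2"
    by metis
  have "K \<subseteq> \<Union> ((\<lambda>x. ball x (d x)) ` K)" using d(1) by force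
  then obtain r where r: "r > 0" "\<And>x. x \<in> K \<Longrightarrow> \<exists>y\<in>K. ball x r \<subseteq> ball y (d y)"
    using Heine_Borel_lemma[OF K(1)] by (smt (verit, ccfv_SIG) imageE open_ball)
  show "\<forall>\<^sub>F e in \<F>. \<forall>x\<in>S. dist (F (f e x)) (F (g x)) < \<epsilon>"
    using uniform_limitD[OF lim r(1)] ev
  proof eventually_elim
    case (elim e)
    show ?case
    proof
      fix x assume x: "x \<in> S"
      then have gx: "g x \<in> K" using K(3) by blast
      then obtain y where y: "y \<in> K" "ball (g x) r \<subseteq> ball y (d y)" using r(2) by blast
      have "f e x \<in> ball (g x) r" "g x \<in> ball (g x) r"
        using r(1) elim(1) x by (auto simp: dist_commute)
      then have "f e x \<in> ball y (d y)" "g x \<in> ball y (d y)"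
        using y(2) by blast+
      then have "dist (F (f e x)) (F y) < \<epsilon> / 2" "dist (F (g x)) (F y) < \<epsilon> / 2"
        using d(2) y(1) gx K(2) elim(2) x by (auto simp: dist_commute)
      then show "dist (F (f e x)) (F (g x)) < \<epsilon>"
        by (rule dist_triangle_half_l)
    qed
  qed
qed

lemma uniform_limit_Pair:
  assumes "uniform_limit S f l \<F>" and "uniform_limit S g m \<F>"
  shows "uniform_limit S (\<lambda>e x. (f e x, g e x)) (\<lambda>x. (l x, m x)) \<F>"
proof (rule uniform_limitI)
  fix \<epsilon> :: real assume "\<epsilon> > 0"
  then have "\<epsilon> / 2 > 0" by simp
  show "\<forall>\<^sub>F e in \<F>. \<forall>x\<in>S. dist (f e x, g e x) (l x, m x) < \<epsilon>"
    using uniform_limitD[OF assms(1) \<open>\<epsilon> / 2 > 0\<close>] uniform_limitD[OF assms(2) \<open>\<epsilon> / 2 > 0\<close>]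
  proof eventually_elim
    case (elim e)
    have "dist (f e x, g e x) (l x, m x) < \<epsilon>" if "x \<in> S" for x
    proof -
      have "dist (f e x, g e x) (l x, m x) \<le> dist (f e x) (l x) + dist (g e x) (m x)"
        unfolding dist_Pair_Pair by (rule sqrt_sum_squares_le_sum) auto
      then show ?thesis using elim that by fastforce
    qed
    then show ?case by blast
  qed
qed

text \<open>Multiply the quotients by \<epsilon>, which tends to 0. Boundedness of the limit
  \<delta> keeps the convergence of the product uniform.\<close>

lemma uniform_limit_of_difference_quotients:
  fixes z :: "real \<Rightarrow> 'b \<Rightarrow> 'a::real_normed_vector"
  assumes "uniform_limit S (\<lambda>\<epsilon> t. (z \<epsilon> t - z 0 t) /\<^sub>R \<epsilon>) \<delta> (at 0)" and "bounded (\<delta> ` S)"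
  shows "uniform_limit S (\<lambda>\<epsilon> t. z \<epsilon> t - z 0 t) (\<lambda>_. 0) (at 0)"
proof -
  have "uniform_limit S (\<lambda>\<epsilon> t. \<epsilon>) (\<lambda>_. 0::real) (at 0)"
  proof (rule uniform_limitI)
    fix e :: real assume "e > 0"
    then show "\<forall>\<^sub>F \<epsilon> in at 0. \<forall>t\<in>S. dist \<epsilon> 0 < e"
      by (rule eventually_mono[OF tendstoD[OF tendsto_ident_at]]) auto
  qed
  then have "uniform_limit S (\<lambda>\<epsilon> t. \<epsilon> *\<^sub>R ((z \<epsilon> t - z 0 t) /\<^sub>R \<epsilon>)) (\<lambda>t. 0 *\<^sub>R \<delta> t) (at 0)"
    by (intro bounded_bilinear_bounded_uniform_limit_intros assms) (auto simp: image_constant_conv)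
  then show ?thesis
    by (rule uniform_limit_cong[THEN iffD1, rotated -1])
      (auto simp: eventually_at intro!: exI[of _ 1])
qed

section \<open>Partial derivatives of the Hamiltonian\<close>

text \<open>Smoothness yields a total derivative within the closed time slab, continuous one
  direction at a time. This is converted into the form needed for the action: a derivative in the
  phase space variables, written with \<open>D_q\<close> and \<open>D_p\<close>, and jointly
  continuous in base point and direction.\<close>

lemma smooth_Hamiltonian_derivative:
  fixes H :: "real \<times> 'q::real_normed_vector \<times> 'q dual \<Rightarrow> real"
  assumes fd: "finite_dimensional TYPE('q)" and smooth: "smooth_on (I \<times> UNIV \<times> UNIV) H"
  shows "continuous_on (I \<times> UNIV) H"
    and "\<And>t x y. t \<in> I \<Longrightarrow> ((\<lambda>z. H (t, z)) has_derivative
      (\<lambda>(u, w). blinfun_apply (D_q H t x y) u + blinfun_apply w (D_p H t x y))) (at (x, y))"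
    and "continuous_on (I \<times> UNIV)
      (\<lambda>(t, (x, y), (u, w)). blinfun_apply (D_q H t x y) u + blinfun_apply w (D_p H t x y))"
proof -
  let ?S = "I \<times> (UNIV :: ('q \<times> 'q dual) set)"
  have "Ck_on 1 ?S H" using smooth by (simp add: smooth_on_def)
  then obtain H' where H': "\<And>z. z \<in> ?S \<Longrightarrow> (H has_derivative H' z) (at z within ?S)"
    and cont: "\<And>v. continuous_on ?S (\<lambda>z. H' z v)"
    by auto
  show "continuous_on ?S H"
    using H' by (rule has_derivative_continuous_on)
  \<comment> \<open>A time slice is a whole copy of phase space, so the derivative within the slab
    becomes an unrestricted one, even if \<open>t\<close> is an end point of
    \<open>I\<close>.\<close>
  have slice: "((\<lambda>z. H (t, z)) has_derivative (\<lambda>v. H' (t, z) (0, v))) (at z)" if "t \<in> I" for t z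
  proof -
    have "(Pair t has_derivative (\<lambda>v. (0, v))) (at z)"
      by (auto intro!: derivative_eq_intros)
    moreover have "(H has_derivative H' (t, z)) (at (t, z) within range (Pair t))"
      using H'[of "(t, z)"] that by (rule_tac has_derivative_subset[of _ _ _ ?S]) auto
    ultimately show ?thesis
      using diff_chain_within[of "Pair t" _ z UNIV H "H' (t, z)"] by (simp add: o_def)
  qed
  have lin: "linear (\<lambda>v. H' (t, z) (0, v))" if "t \<in> I" for t z
    using slice[OF that] by (rule has_derivative_linear)
  have q: "blinfun_apply (D_q H t x y) u = H' (t, x, y) (0, u, 0)" if "t \<in> I" for t x y u
  proof -
    have "((\<lambda>x. (x, y)) has_derivative (\<lambda>u. (u, 0))) (at x)"
      by (auto intro!: derivative_eq_intros)
    then have der: "((\<lambda>x. H (t, x, y)) has_derivative (\<lambda>u. H' (t, x, y) (0, u, 0))) (at x)"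
      using diff_chain_at slice[OF that, of "(x, y)"] by (fastforce simp: o_def)
    then show ?thesis
      unfolding D_q_def frechet_derivative_at[OF der, symmetric]
      by (simp add: bounded_linear_Blinfun_apply has_derivative_bounded_linear)
  qed
  have p: "blinfun_apply w (D_p H t x y) = H' (t, x, y) (0, 0, w)" if "t \<in> I" for t x y w
  proof -
    have "(Pair x has_derivative Pair 0) (at y)"
      by (auto intro!: derivative_eq_intros)
    then have der: "((\<lambda>y. H (t, x, y)) has_derivative (\<lambda>w. H' (t, x, y) (0, 0, w))) (at y)"
      using diff_chain_at slice[OF that, of "(x, y)"] by (fastforce simp: o_def)
    \<comment> \<open>The derivative in the momentum is a linear functional on the dual, so the
      description defining \<open>D_p\<close> does denote its representing vector.\<close>
    have "(\<lambda>w. H' (t, x, y) (0, 0, w)) = (\<lambda>\<alpha>. blinfun_apply \<alpha> (D_p H t x y))"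
      unfolding D_p_def frechet_derivative_at[OF der, symmetric]
      by (rule theI'[OF bidual_represented[OF fd has_derivative_linear[OF der]]])
    then show ?thesis by metis
  qed
  have sum: "H' (t, x, y) (0, u, w) = blinfun_apply (D_q H t x y) u + blinfun_apply w (D_p H t x y)"
    if "t \<in> I" for t x y u w
    using linear_add[OF lin[OF that], of "(x, y)" "(u, 0)" "(0, w)"] that by (simp add: q p)
  show "((\<lambda>z. H (t, z)) has_derivative
      (\<lambda>(u, w). blinfun_apply (D_q H t x y) u + blinfun_apply w (D_p H t x y))) (at (x, y))"
    if "t \<in> I" for t x y
    using slice[OF that, of "(x, y)"] by (simp add: case_prod_unfold flip: sum[OF that])
  obtain B :: "'q set" and \<phi> :: "'q \<Rightarrow> 'q dual" where
    B: "finite B" "\<And>x. x = (\<Sum>b\<in>B. blinfun_apply (\<phi> b) x *\<^sub>R b)"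
    using finite_dimensional_dual_basis[OF fd] by blast
  have coord: "blinfun_apply \<alpha> x = (\<Sum>b\<in>B. blinfun_apply (\<phi> b) x * blinfun_apply \<alpha> b)"
    for \<alpha> :: "'q dual" and x
    using arg_cong[OF B(2)[of x], of "blinfun_apply \<alpha>"]
    by (simp add: blinfun.sum_right blinfun.scaleR_right)
  \<comment> \<open>Expanding the directions \<open>u\<close> and \<open>w\<close> leaves
    \<open>H'\<close> evaluated only at fixed basis directions, where continuity is known; the
    coefficients depend continuously on \<open>u\<close> and \<open>w\<close>.\<close>
  have "continuous_on (I \<times> UNIV) (\<lambda>(t, (x, y), (u, w)).
      (\<Sum>b\<in>B. blinfun_apply (\<phi> b) u * H' (t, x, y) (0, b, 0)) +
      (\<Sum>b\<in>B. H' (t, x, y) (0, 0, \<phi> b) * blinfun_apply w b))"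
    unfolding case_prod_unfold
    by (intro continuous_intros continuous_on_compose2[OF cont]) auto
  moreover have "(\<Sum>b\<in>B. blinfun_apply (\<phi> b) u * H' (t, x, y) (0, b, 0)) +
      (\<Sum>b\<in>B. H' (t, x, y) (0, 0, \<phi> b) * blinfun_apply w b) =
      blinfun_apply (D_q H t x y) u + blinfun_apply w (D_p H t x y)" if "t \<in> I" for t x y u w
    using that coord[of "D_q H t x y" u] coord[of w "D_p H t x y"] by (simp add: q p)
  ultimately show "continuous_on (I \<times> UNIV)
      (\<lambda>(t, (x, y), (u, w)). blinfun_apply (D_q H t x y) u + blinfun_apply w (D_p H t x y))"
    by (subst continuous_on_cong[OF refl, rotated]) (auto simp: case_prod_unfold)
qed

section \<open>Differentiation under the integral sign\<close>

text \<open>By the mean value theorem the quotient equals \<open>L'\<close> at a point of the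
  segment from \<open>z 0 t\<close> to \<open>z \<epsilon> t\<close>, in the direction of the
  difference quotient of \<open>z\<close>. Both arguments converge uniformly, with limits in a
  compact set, so joint continuity of \<open>L'\<close> carries the convergence over.\<close>

lemma uniform_difference_quotient_superposition:
  fixes L :: "real \<times> 'a::real_normed_vector \<Rightarrow> real"
  assumes S: "compact S" and z0: "continuous_on S (z 0)" and \<delta>: "continuous_on S \<delta>"
    and L': "\<And>t x. t \<in> S \<Longrightarrow> ((\<lambda>x. L (t, x)) has_derivative L' t x) (at x)"
    and cont: "continuous_on (S \<times> UNIV) (\<lambda>(t, x, v). L' t x v)"
    and lim: "uniform_limit S (\<lambda>\<epsilon> t. (z \<epsilon> t - z 0 t) /\<^sub>R \<epsilon>) \<delta> (at 0)"
  shows "uniform_limit S (\<lambda>\<epsilon> t. (L (t, z \<epsilon> t) - L (t, z 0 t)) / \<epsilon>)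
    (\<lambda>t. L' t (z 0 t) (\<delta> t)) (at 0)"
proof -
  define mean where "mean \<epsilon> t s \<longleftrightarrow> s \<in> {0..1} \<and> L (t, z \<epsilon> t) - L (t, z 0 t) =
      L' t (z 0 t + s *\<^sub>R (z \<epsilon> t - z 0 t)) (z \<epsilon> t - z 0 t)" for \<epsilon> t s
  have ex: "\<exists>s. mean \<epsilon> t s" if "t \<in> S" for \<epsilon> t
  proof -
    let ?c = "\<lambda>s. z 0 t + s *\<^sub>R (z \<epsilon> t - z 0 t)"
    have "((\<lambda>s. L (t, ?c s)) has_derivative
        (\<lambda>h. L' t (?c s) (h *\<^sub>R (z \<epsilon> t - z 0 t)))) (at s within {0..1})" for s
      by (rule has_derivative_compose[OF _ L'[OF that]]) (auto intro!: derivative_eq_intros)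
    then have "\<exists>s\<in>{0..1}. L (t, ?c 1) - L (t, ?c 0) = L' t (?c s) ((1 - 0) *\<^sub>R (z \<epsilon> t - z 0 t))"
      by (intro mvt_very_simple) auto
    then show ?thesis by (auto simp: mean_def)
  qed
  \<comment> \<open>The intermediate parameter is chosen separately for each \<epsilon> and
    \<open>t\<close>, possibly discontinuously in \<open>t\<close>. Its bound by 1 makes the
    intermediate points converge uniformly.\<close>
  define s where "s \<epsilon> t = (SOME s. mean \<epsilon> t s)" for \<epsilon> t
  have "mean \<epsilon> t (s \<epsilon> t)" if "t \<in> S" for \<epsilon> t
    unfolding s_def by (rule someI_ex[OF ex[OF that]])
  then have s: "\<And>\<epsilon> t. t \<in> S \<Longrightarrow> s \<epsilon> t \<in> {0..1}"
    "\<And>\<epsilon> t. t \<in> S \<Longrightarrow> L (t, z \<epsilon> t) - L (t, z 0 t) =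
      L' t (z 0 t + s \<epsilon> t *\<^sub>R (z \<epsilon> t - z 0 t)) (z \<epsilon> t - z 0 t)"
    unfolding mean_def by blast+
  have "bounded (\<delta> ` S)"
    using \<delta> S by (intro compact_imp_bounded compact_continuous_image)
  note diff = uniform_limit_of_difference_quotients[OF lim this]
  have "uniform_limit S (\<lambda>\<epsilon> t. s \<epsilon> t *\<^sub>R (z \<epsilon> t - z 0 t)) (\<lambda>_. 0) (at 0)"
  proof (rule uniform_limitI)
    fix e :: real assume "e > 0"
    from uniform_limitD[OF diff this]
    show "\<forall>\<^sub>F \<epsilon> in at 0. \<forall>t\<in>S. dist (s \<epsilon> t *\<^sub>R (z \<epsilon> t - z 0 t)) 0 < e"
    proof eventually_elim
      case (elim \<epsilon>)
      have "norm (s \<epsilon> t *\<^sub>R (z \<epsilon> t - z 0 t)) \<le> norm (z \<epsilon> t - z 0 t)" if "t \<in> S" for t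
        using s(1)[OF that, of \<epsilon>] by (simp add: mult_left_le_one_le)
      then show ?case using elim by fastforce
    qed
  qed
  from uniform_limit_add[OF uniform_limit_const[where c = "z 0" and S = S] this]
  have "uniform_limit S (\<lambda>\<epsilon> t. z 0 t + s \<epsilon> t *\<^sub>R (z \<epsilon> t - z 0 t)) (z 0) (at 0)"
    by simp
  note args = uniform_limit_Pair[OF uniform_limit_const[where c = "\<lambda>t. t" and S = S] uniform_limit_Pair[OF this lim]]
  have composed: "uniform_limit S (\<lambda>\<epsilon> t. (\<lambda>(t, x, v). L' t x v)
      (t, z 0 t + s \<epsilon> t *\<^sub>R (z \<epsilon> t - z 0 t), (z \<epsilon> t - z 0 t) /\<^sub>R \<epsilon>))
      (\<lambda>t. (\<lambda>(t, x, v). L' t x v) (t, z 0 t, \<delta> t)) (at 0)"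
  proof (rule uniform_limit_compose_compact[OF cont _ _ _ args])
    show "compact ((\<lambda>t. (t, z 0 t, \<delta> t)) ` S)"
      by (intro compact_continuous_image continuous_intros z0 \<delta> S)
  qed auto
  \<comment> \<open>Linearity in the direction absorbs the factor. At \<open>\<epsilon> = 0\<close>
    both sides are 0 by the convention on division.\<close>
  have quotient: "L' t (z 0 t + s \<epsilon> t *\<^sub>R (z \<epsilon> t - z 0 t)) ((z \<epsilon> t - z 0 t) /\<^sub>R \<epsilon>) =
      (L (t, z \<epsilon> t) - L (t, z 0 t)) / \<epsilon>" if "t \<in> S" for \<epsilon> t
    using s(2)[OF that, of \<epsilon>] linear_cmul[OF has_derivative_linear[OF L'[OF that]]]
    by (simp add: divide_inverse mult.commute)
  show ?thesis
    by (rule uniform_limit_cong'[THEN iffD1, rotated -1, OF composed]) (simp_all add: quotient)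
qed

text \<open>Uniform convergence of the integrand's difference quotients passes to their integrals.
  The state space is left general so that the velocity can later be one of its components.\<close>

lemma integral_has_derivative_along_family:
  fixes L :: "real \<times> 'a::real_normed_vector \<Rightarrow> real"
  assumes L: "continuous_on ({a..b} \<times> UNIV) L"
    and L': "\<And>t x. t \<in> {a..b} \<Longrightarrow> ((\<lambda>x. L (t, x)) has_derivative L' t x) (at x)"
    and cont: "continuous_on ({a..b} \<times> UNIV) (\<lambda>(t, x, v). L' t x v)"
    and z: "\<forall>\<^sub>F \<epsilon> in nhds 0. continuous_on {a..b} (z \<epsilon>)" and \<delta>: "continuous_on {a..b} \<delta>"
    and lim: "uniform_limit {a..b} (\<lambda>\<epsilon> t. (z \<epsilon> t - z 0 t) /\<^sub>R \<epsilon>) \<delta> (at 0)"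
  shows "((\<lambda>\<epsilon>. integral {a..b} (\<lambda>t. L (t, z \<epsilon> t))) has_real_derivative
    integral {a..b} (\<lambda>t. L' t (z 0 t) (\<delta> t))) (at 0)"
proof -
  have z0: "continuous_on {a..b} (z 0)"
    using z by (rule eventually_nhds_x_imp_x)
  have cont_L: "continuous_on {a..b} (\<lambda>t. L (t, z \<epsilon> t))" if "continuous_on {a..b} (z \<epsilon>)" for \<epsilon>
    by (rule continuous_on_compose2[OF L]) (auto intro!: continuous_intros that)
  define Q where "Q \<epsilon> t = (L (t, z \<epsilon> t) - L (t, z 0 t)) / \<epsilon>" for \<epsilon> t
  \<comment> \<open>The curves are known to be continuous only for small \<open>\<epsilon>\<close>.\<close>
  define Q' where "Q' \<epsilon> = (if continuous_on {a..b} (z \<epsilon>) then Q \<epsilon> else (\<lambda>_. 0))" for \<epsilon>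
  have ev: "\<forall>\<^sub>F \<epsilon> in at 0. continuous_on {a..b} (z \<epsilon>)"
    using z by (simp add: eventually_nhds_conv_at)
  have "uniform_limit {a..b} Q (\<lambda>t. L' t (z 0 t) (\<delta> t)) (at 0)"
    unfolding Q_def
    by (rule uniform_difference_quotient_superposition[OF _ z0 \<delta> L' cont lim]) auto
  then have Q'_lim: "uniform_limit {a..b} Q' (\<lambda>t. L' t (z 0 t) (\<delta> t)) (at 0)"
    by (rule uniform_limit_cong[THEN iffD1, rotated -1])
      (use ev in \<open>auto simp: Q'_def elim: eventually_mono\<close>)
  have Q'_cont: "continuous_on {a..b} (Q' \<epsilon>)" for \<epsilon>
    unfolding Q'_def Q_def by (auto intro!: continuous_intros cont_L z0 simp: divide_inverse)
  obtain I J where IJ: "\<And>\<epsilon>. (Q' \<epsilon> has_integral I \<epsilon>) {a..b}"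
    "((\<lambda>t. L' t (z 0 t) (\<delta> t)) has_integral J) {a..b}" "(I \<longlongrightarrow> J) (at 0)"
    by (rule uniform_limit_integral[OF Q'_lim Q'_cont at_neq_bot]) (rule that)
  have "((\<lambda>\<epsilon>. integral {a..b} (Q' \<epsilon>)) \<longlongrightarrow> integral {a..b} (\<lambda>t. L' t (z 0 t) (\<delta> t))) (at 0)"
    using IJ(3) by (simp add: integral_unique[OF IJ(1)] integral_unique[OF IJ(2)])
  moreover have "\<forall>\<^sub>F \<epsilon> in at 0. integral {a..b} (Q' \<epsilon>) =
      (integral {a..b} (\<lambda>t. L (t, z \<epsilon> t)) - integral {a..b} (\<lambda>t. L (t, z 0 t))) / (\<epsilon> - 0)"
    using ev
  proof eventually_elim
    case (elim \<epsilon>)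
    show ?case
      unfolding Q'_def Q_def if_P[OF elim] integral_divide
      by (subst integral_diff) (auto intro!: integrable_continuous_real cont_L z0 elim)
  qed
  ultimately show ?thesis
    unfolding has_field_derivative_iff by (rule Lim_transform_eventually)
qed

section \<open>Continuously differentiable curves on a closed interval\<close>

lemma velocity_eqI:
  assumes "T > 0" and "t \<in> {0..T}" and "(c has_vector_derivative v) (at t within {0..T})"
  shows "velocity T c t = v"
  using assms vector_derivative_within_cbox[of 0 T t c v] by simp

text \<open>A linear map on the real line is determined by its value at 1, so the directional
  formulation in \<open>Ck_on\<close> amounts to a continuous velocity. Positive length of the
  interval makes the one-sided derivative unique.\<close>

lemma Ck_on_1_iff_velocity:
  assumes "T > 0"
  shows "Ck_on 1 {0..T} c \<longleftrightarrow>
    (\<forall>t\<in>{0..T}. (c has_vector_derivative velocity T c t) (at t within {0..T})) \<and>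
    continuous_on {0..T} (velocity T c)"
proof
  assume "Ck_on 1 {0..T} c"
  then have "\<exists>c'. (\<forall>t\<in>{0..T}. (c has_derivative c' t) (at t within {0..T})) \<and>
      (\<forall>v. continuous_on {0..T} (\<lambda>t. c' t v))"
    by simp
  then obtain c' where c': "\<forall>t\<in>{0..T}. (c has_derivative c' t) (at t within {0..T})"
    and cont: "\<forall>v. continuous_on {0..T} (\<lambda>t. c' t v)"
    by blast
  have der: "(c has_vector_derivative c' t 1) (at t within {0..T})" if "t \<in> {0..T}" for t
  proof -
    have "(c has_derivative c' t) (at t within {0..T})"
      using c' that by blast
    moreover have "c' t h = h *\<^sub>R c' t 1" for h
      using linear_cmul[OF has_derivative_linear[OF calculation], of h 1] by simp
    then have "c' t = (\<lambda>h. h *\<^sub>R c' t 1)"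
      by (rule ext)
    ultimately show ?thesis
      unfolding has_vector_derivative_def by (rule subst[rotated])
  qed
  then have "velocity T c t = c' t 1" if "t \<in> {0..T}" for t
    using velocity_eqI[OF assms that] that by blast
  then show "(\<forall>t\<in>{0..T}. (c has_vector_derivative velocity T c t) (at t within {0..T})) \<and>
      continuous_on {0..T} (velocity T c)"
    using der cont[THEN spec, of 1] by (simp cong: continuous_on_cong_simp)
next
  assume c: "(\<forall>t\<in>{0..T}. (c has_vector_derivative velocity T c t) (at t within {0..T})) \<and>
    continuous_on {0..T} (velocity T c)"
  have "\<exists>c'. (\<forall>t\<in>{0..T}. (c has_derivative c' t) (at t within {0..T})) \<and>
      (\<forall>v. continuous_on {0..T} (\<lambda>t. c' t v))"
  proof (intro exI[of _ "\<lambda>t h. h *\<^sub>R velocity T c t"] conjI ballI allI)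
    show "(c has_derivative (\<lambda>h. h *\<^sub>R velocity T c t)) (at t within {0..T})" if "t \<in> {0..T}" for t
      using c that unfolding has_vector_derivative_def by blast
    show "continuous_on {0..T} (\<lambda>t. h *\<^sub>R velocity T c t)" for h
      using c by (intro continuous_intros) blast
  qed
  then show "Ck_on 1 {0..T} c"
    by simp
qed

lemma Ck_on_1_velocity:
  assumes "T > 0" and "Ck_on 1 {0..T} c"
  shows "t \<in> {0..T} \<Longrightarrow> (c has_vector_derivative velocity T c t) (at t within {0..T})"
    and "continuous_on {0..T} (velocity T c)"
    and "continuous_on {0..T} c"
proof -
  have *: "\<forall>t\<in>{0..T}. (c has_vector_derivative velocity T c t) (at t within {0..T})"
    "continuous_on {0..T} (velocity T c)"
    using Ck_on_1_iff_velocity[OF assms(1)] assms(2) by blast+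
  then show "t \<in> {0..T} \<Longrightarrow> (c has_vector_derivative velocity T c t) (at t within {0..T})"
    and "continuous_on {0..T} (velocity T c)"
    by blast+
  show "continuous_on {0..T} c"
    using *(1) by (intro continuous_on_vector_derivative) blast
qed

lemma Ck_on_1_velocityI:
  assumes "T > 0" and "\<And>t. t \<in> {0..T} \<Longrightarrow> (c has_vector_derivative c' t) (at t within {0..T})"
    and "continuous_on {0..T} c'"
  shows "Ck_on 1 {0..T} c"
proof -
  have "velocity T c t = c' t" if "t \<in> {0..T}" for t
    using velocity_eqI[OF assms(1) that assms(2)[OF that]] .
  then show ?thesis
    using assms by (simp add: Ck_on_1_iff_velocity del: One_nat_def cong: continuous_on_cong_simp)
qed

lemma Ck_on_1_bounded_linear:
  assumes "T > 0" and "bounded_linear f" and "Ck_on 1 {0..T} h"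
  shows "Ck_on 1 {0..T} (\<lambda>t. f (h t))"
    and "t \<in> {0..T} \<Longrightarrow> velocity T (\<lambda>t. f (h t)) t = f (velocity T h t)"
proof -
  have der: "((\<lambda>t. f (h t)) has_vector_derivative f (velocity T h t)) (at t within {0..T})"
    if "t \<in> {0..T}" for t
    using bounded_linear.has_vector_derivative[OF assms(2) Ck_on_1_velocity(1)[OF assms(1,3) that]] .
  show "Ck_on 1 {0..T} (\<lambda>t. f (h t))"
    by (rule Ck_on_1_velocityI[OF assms(1) der], assumption)
      (rule bounded_linear.continuous_on[OF assms(2) Ck_on_1_velocity(2)[OF assms(1,3)]])
  show "t \<in> {0..T} \<Longrightarrow> velocity T (\<lambda>t. f (h t)) t = f (velocity T h t)"
    by (rule velocity_eqI[OF assms(1) _ der])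
qed

section \<open>The fundamental lemma of the calculus of variations\<close>

lemma fundamental_lemma_free_endpoint:
  fixes g :: "real \<Rightarrow> real"
  assumes T: "T > 0" and g: "continuous_on {0..T} g"
    and test: "\<And>h. \<lbrakk>Ck_on 1 {0..T} h; h 0 = 0\<rbrakk> \<Longrightarrow> integral {0..T} (\<lambda>t. g t * h t) = k * h T"
  shows "\<forall>t\<in>{0..T}. g t = 0" and "k = 0"
proof -
  \<comment> \<open>The function \<open>u\<close> is chosen so that \<open>u' = - g\<close> and \<open>u(T) = - k\<close>: then testing with its
    primitive \<open>h\<close> and integrating \<open>(u h)'\<close> gives \<open>\<integral> u\<^sup>2 = 0\<close>.\<close>
  define G where "G t = integral {0..t} g" for t
  define u where "u t = G T - k - G t" for t
  define h where "h t = integral {0..t} u" for t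
  have G': "(G has_vector_derivative g t) (at t within {0..T})" if "t \<in> {0..T}" for t
    unfolding G_def by (rule integral_has_vector_derivative[OF g that])
  then have "continuous_on {0..T} G"
    by (rule continuous_on_vector_derivative)
  then have u: "continuous_on {0..T} u"
    unfolding u_def by (intro continuous_intros)
  have h': "(h has_vector_derivative u t) (at t within {0..T})" if "t \<in> {0..T}" for t
    unfolding h_def by (rule integral_has_vector_derivative[OF u that])
  have u': "(u has_vector_derivative - g t) (at t within {0..T})" if "t \<in> {0..T}" for t
    unfolding u_def using G'[OF that] by (auto intro!: derivative_eq_intros)
  have h: "continuous_on {0..T} h"
    using h' by (rule continuous_on_vector_derivative)
  have "((\<lambda>t. u t * u t + (- g t) * h t) has_integral (u T * h T - u 0 * h 0)) {0..T}"
    by (intro fundamental_theorem_of_calculus has_vector_derivative_mult u' h') (use T in auto)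
  then have parts: "((\<lambda>t. u t * u t + (- g t) * h t) has_integral (- k * h T)) {0..T}"
    by (simp add: u_def h_def)
  have "integral {0..T} (\<lambda>t. g t * h t) = k * h T"
    by (rule test[OF Ck_on_1_velocityI[OF T h' u]]) (simp_all add: h_def)
  moreover have "(\<lambda>t. g t * h t) integrable_on {0..T}"
    by (intro integrable_continuous_real continuous_intros g h)
  ultimately have "((\<lambda>t. g t * h t) has_integral k * h T) {0..T}"
    by (simp add: has_integral_iff)
  from has_integral_add[OF parts this] have "((\<lambda>t. u t * u t) has_integral 0) {0..T}"
    by simp
  \<comment> \<open>A continuous nonnegative function with integral 0 vanishes on the interval, end
    points included.\<close>
  then have u0: "u t = 0" if "t \<in> {0..T}" for t
    using has_integral_0_cbox_imp_0[of 0 T "\<lambda>t. u t * u t" t] that T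
    by (auto intro!: continuous_intros u)
  show "k = 0"
    using u0[of T] T by (simp add: u_def)
  show "\<forall>t\<in>{0..T}. g t = 0"
  proof
    fix t assume t: "t \<in> {0..T}"
    \<comment> \<open>Since \<open>u\<close> vanishes identically, its derivative within the
      interval is 0 as well as \<open>- g t\<close>; uniqueness covers the end points too.\<close>
    have "(u has_vector_derivative 0) (at t within {0..T})"
      by (rule has_vector_derivative_transform[OF t _ has_vector_derivative_const[of 0]]) (simp add: u0)
    from velocity_eqI[OF T t this] velocity_eqI[OF T t u'[OF t]] show "g t = 0" by simp
  qed
qed

section \<open>The first variation of the action\<close>

text \<open>The integrand is a function of time, position, momentum and velocity. Convergence of a
  family in the \<open>C^1\<close> sense supplies uniform limits of the difference quotients of
  exactly these three state components, so the general differentiation lemma applies.\<close>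

lemma has_real_derivative_action:
  fixes H :: "real \<times> 'q::real_normed_vector \<times> 'q dual \<Rightarrow> real"
  assumes fd: "finite_dimensional TYPE('q)" and T: "T > 0"
    and smooth: "smooth_on ({0..T} \<times> UNIV \<times> UNIV) H"
    and qp: "(q, p) \<in> C1_curves T q0"
    and var: "partial_variation T \<delta>q \<delta>p" and gen: "generates_variation T q0 q p qf pf \<delta>q \<delta>p"
  shows "((\<lambda>\<epsilon>. action H T (qf \<epsilon>) (pf \<epsilon>)) has_real_derivative
    integral {0..T} (\<lambda>t. blinfun_apply (p t) (velocity T \<delta>q t)
      - blinfun_apply (D_q H t (q t) (p t)) (\<delta>q t)
      + blinfun_apply (\<delta>p t) (velocity T q t - D_p H t (q t) (p t)))) (at 0)"
proof -
  have H: "continuous_on ({0..T} \<times> UNIV) H"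
    and DH: "\<And>t x y. t \<in> {0..T} \<Longrightarrow> ((\<lambda>z. H (t, z)) has_derivative
      (\<lambda>(u, w). blinfun_apply (D_q H t x y) u + blinfun_apply w (D_p H t x y))) (at (x, y))"
    and DH_cont: "continuous_on ({0..T} \<times> UNIV)
      (\<lambda>(t, (x, y), (u, w)). blinfun_apply (D_q H t x y) u + blinfun_apply w (D_p H t x y))"
    by (fact smooth_Hamiltonian_derivative[OF fd smooth])+
  \<comment> \<open>The velocity is carried as an independent third component of the state.\<close>
  define L where "L = (\<lambda>(t, x, y :: 'q dual, v). blinfun_apply y v - H (t, x, y))"
  define L' where "L' t = (\<lambda>(x, y :: 'q dual, v) (u, w :: 'q dual, a).
    blinfun_apply y a + blinfun_apply w v -
    (blinfun_apply (D_q H t x y) u + blinfun_apply w (D_p H t x y)))" for t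
  define z where "z \<epsilon> t = (qf \<epsilon> t, pf \<epsilon> t, velocity T (qf \<epsilon>) t)" for \<epsilon> t
  define \<delta> where "\<delta> t = (\<delta>q t, \<delta>p t, velocity T \<delta>q t)" for t
  have "((\<lambda>\<epsilon>. integral {0..T} (\<lambda>t. L (t, z \<epsilon> t))) has_real_derivative
      integral {0..T} (\<lambda>t. L' t (z 0 t) (\<delta> t))) (at 0)"
  proof (rule integral_has_derivative_along_family)
    show "continuous_on ({0..T} \<times> UNIV) L"
      unfolding L_def case_prod_unfold
      by (intro continuous_intros continuous_on_compose2[OF H]) auto
    show "((\<lambda>x. L (t, x)) has_derivative L' t x) (at x)" if t: "t \<in> {0..T}" for t x
    proof -
      obtain x1 y v where x: "x = (x1, y, v)" by (cases x)
      have "((\<lambda>z. (fst z, fst (snd z))) has_derivative (\<lambda>d. (fst d, fst (snd d)))) (at x)"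
        by (auto intro!: derivative_eq_intros)
      moreover have "((\<lambda>z. H (t, z)) has_derivative (\<lambda>(u, w). blinfun_apply (D_q H t x1 y) u +
          blinfun_apply w (D_p H t x1 y))) (at (fst x, fst (snd x)))"
        using DH[OF t, of x1 y] by (simp add: x)
      ultimately have "((\<lambda>z. H (t, fst z, fst (snd z))) has_derivative
          (\<lambda>d. blinfun_apply (D_q H t x1 y) (fst d) + blinfun_apply (fst (snd d)) (D_p H t x1 y))) (at x)"
        by (auto dest: has_derivative_compose)
      moreover have "((\<lambda>z. blinfun_apply (fst (snd z)) (snd (snd z))) has_derivative
          (\<lambda>d. blinfun_apply y (snd (snd d)) + blinfun_apply (fst (snd d)) v)) (at x)"
        by (auto intro!: derivative_eq_intros simp: x)
      ultimately show ?thesis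
        unfolding L_def L'_def x case_prod_unfold fst_conv snd_conv by (rule has_derivative_diff[rotated])
    qed
    show "continuous_on ({0..T} \<times> UNIV) (\<lambda>(t, x, v). L' t x v)"
    proof -
      have D: "continuous_on ({0..T} \<times> UNIV) (\<lambda>d :: real \<times> ('q \<times> 'q dual \<times> 'q) \<times> ('q \<times> 'q dual \<times> 'q).
        (\<lambda>(t, (x, y), (u, w)). blinfun_apply (D_q H t x y) u + blinfun_apply w (D_p H t x y))
        (fst d, (fst (fst (snd d)), fst (snd (fst (snd d)))),
          (fst (snd (snd d)), fst (snd (snd (snd d))))))"
        by (intro continuous_intros continuous_on_compose2[OF DH_cont]) auto
      show ?thesis
        unfolding L'_def case_prod_unfold
        by (rule continuous_on_diff, intro continuous_intros) (use D in \<open>simp add: case_prod_unfold\<close>)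
    qed
    have z_cont: "continuous_on {0..T} (\<lambda>t. (x t, y t, velocity T x t))"
      if "Ck_on 1 {0..T} x" "Ck_on 1 {0..T} y" for x :: "real \<Rightarrow> 'q" and y :: "real \<Rightarrow> 'q dual"
      by (intro continuous_on_Pair) (fact Ck_on_1_velocity(2,3)[OF T that(1)] Ck_on_1_velocity(3)[OF T that(2)])+
    show "\<forall>\<^sub>F \<epsilon> in nhds 0. continuous_on {0..T} (z \<epsilon>)"
      using gen unfolding generates_variation_def z_def C1_curves_def
      by (elim conjE eventually_mono) (use z_cont in blast)
    show "continuous_on {0..T} \<delta>"
      using var unfolding partial_variation_def \<delta>_def by (intro z_cont) blast+
    show "uniform_limit {0..T} (\<lambda>\<epsilon> t. (z \<epsilon> t - z 0 t) /\<^sub>R \<epsilon>) \<delta> (at 0)"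
      using gen unfolding generates_variation_def C1_family_derivative_def z_def \<delta>_def
      by (auto intro!: uniform_limit_Pair)
  qed
  \<comment> \<open>\<open>qf 0\<close> and \<open>q\<close> agree only on the interval, so their
    velocities are compared through derivatives within it.\<close>
  moreover have "velocity T (qf 0) t = velocity T q t" if "t \<in> {0..T}" for t
  proof (rule velocity_eqI[OF T that])
    have "Ck_on 1 {0..T} q" using qp by (simp add: C1_curves_def)
    then show "(qf 0 has_vector_derivative velocity T q t) (at t within {0..T})"
      using gen unfolding generates_variation_def
      by (intro has_vector_derivative_transform[OF that _ Ck_on_1_velocity(1)[OF T _ that]]) auto
  qed
  then have "integral {0..T} (\<lambda>t. L' t (z 0 t) (\<delta> t)) =
      integral {0..T} (\<lambda>t. blinfun_apply (p t) (velocity T \<delta>q t)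
      - blinfun_apply (D_q H t (q t) (p t)) (\<delta>q t)
      + blinfun_apply (\<delta>p t) (velocity T q t - D_p H t (q t) (p t)))"
    using gen by (intro integral_cong) (auto simp: L'_def z_def \<delta>_def generates_variation_def
        blinfun.diff_right)
  ultimately show ?thesis
    by (simp add: action_def L_def z_def)
qed

text \<open>For \<epsilon> different from 0 the difference quotients of the line and of its velocity
  do not depend on \<epsilon>, so both limits are limits of constants.\<close>

lemma C1_family_derivative_line:
  assumes T: "T > 0" and "Ck_on 1 {0..T} c" and "Ck_on 1 {0..T} d"
  shows "Ck_on 1 {0..T} (\<lambda>t. c t + \<epsilon> *\<^sub>R d t)"
    and "C1_family_derivative T (\<lambda>\<epsilon> t. c t + \<epsilon> *\<^sub>R d t) d"
proof -
  have der: "((\<lambda>t. c t + \<epsilon> *\<^sub>R d t) has_vector_derivative velocity T c t + \<epsilon> *\<^sub>R velocity T d t)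
      (at t within {0..T})" if "t \<in> {0..T}" for \<epsilon> t
    by (auto intro!: derivative_eq_intros Ck_on_1_velocity(1)[OF T _ that] assms)
  show "Ck_on 1 {0..T} (\<lambda>t. c t + \<epsilon> *\<^sub>R d t)"
    by (rule Ck_on_1_velocityI[OF T der], assumption)
      (intro continuous_intros Ck_on_1_velocity(2)[OF T] assms)
  have vel: "velocity T (\<lambda>t. c t + \<epsilon> *\<^sub>R d t) t = velocity T c t + \<epsilon> *\<^sub>R velocity T d t"
    if "t \<in> {0..T}" for \<epsilon> t
    by (rule velocity_eqI[OF T that der[OF that]])
  have "uniform_limit {0..T} (\<lambda>\<epsilon> t. (c t + \<epsilon> *\<^sub>R d t - (c t + 0 *\<^sub>R d t)) /\<^sub>R \<epsilon>) d (at 0)"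
    by (rule uniform_limit_cong[THEN iffD2, OF _ _ uniform_limit_const])
      (auto simp: eventually_at intro!: exI[of _ 1])
  moreover have "uniform_limit {0..T} (\<lambda>\<epsilon> t. (velocity T (\<lambda>t. c t + \<epsilon> *\<^sub>R d t) t -
      velocity T (\<lambda>t. c t + 0 *\<^sub>R d t) t) /\<^sub>R \<epsilon>) (velocity T d) (at 0)"
    by (rule uniform_limit_cong[THEN iffD2, OF _ _ uniform_limit_const])
      (auto simp: eventually_at vel intro!: exI[of _ 1])
  ultimately show "C1_family_derivative T (\<lambda>\<epsilon> t. c t + \<epsilon> *\<^sub>R d t) d"
    unfolding C1_family_derivative_def by blast
qed

text \<open>Every generating family has the same derivative of the action. The straight line is such
  a family, so the quantifier over families is not vacuous, and uniqueness of derivatives forces the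
  value \<open>d\<close>.\<close>

lemma has_action_variation_iff:
  fixes H :: "real \<times> 'q::real_normed_vector \<times> 'q dual \<Rightarrow> real"
  assumes fd: "finite_dimensional TYPE('q)" and T: "T > 0"
    and smooth: "smooth_on ({0..T} \<times> UNIV \<times> UNIV) H"
    and qp: "(q, p) \<in> C1_curves T q0" and var: "partial_variation T \<delta>q \<delta>p"
  shows "has_action_variation H T q0 q p \<delta>q \<delta>p d \<longleftrightarrow>
    integral {0..T} (\<lambda>t. blinfun_apply (p t) (velocity T \<delta>q t)
      - blinfun_apply (D_q H t (q t) (p t)) (\<delta>q t)
      + blinfun_apply (\<delta>p t) (velocity T q t - D_p H t (q t) (p t))) = d"
proof -
  note der = has_real_derivative_action[OF fd T smooth qp var]
  have "generates_variation T q0 q p (\<lambda>\<epsilon> t. q t + \<epsilon> *\<^sub>R \<delta>q t) (\<lambda>\<epsilon> t. p t + \<epsilon> *\<^sub>R \<delta>p t) \<delta>q \<delta>p"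
  proof -
    have "Ck_on 1 {0..T} q" "Ck_on 1 {0..T} p" "Ck_on 1 {0..T} \<delta>q" "Ck_on 1 {0..T} \<delta>p"
      using qp var by (auto simp: C1_curves_def partial_variation_def simp del: One_nat_def Ck_on.simps)
    from C1_family_derivative_line[OF T this(1,3)] C1_family_derivative_line[OF T this(2,4)]
    show ?thesis
      using qp var unfolding generates_variation_def C1_curves_def partial_variation_def
      by (simp del: One_nat_def Ck_on.simps)
  qed
  then show ?thesis
    using der DERIV_unique unfolding has_action_variation_def by blast
qed

section \<open>Equivalence of the variational principle and Hamilton's equations\<close>

theorem proposition2p2:
  fixes T :: real
    and H :: "real \<times> 'q::real_normed_vector \<times> 'q dual \<Rightarrow> real"
    and q0 :: 'q and p1 :: "'q dual"
    and q :: "real \<Rightarrow> 'q" and p :: "real \<Rightarrow> 'q dual"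
  assumes "finite_dimensional TYPE('q)"
    and "T > 0"
    and "smooth_on ({0..T} \<times> UNIV \<times> UNIV) H"
    and "(q, p) \<in> C1_curves T q0"
  shows "typeII_dAlembert H T q0 p1 q p \<longleftrightarrow>
    (\<forall>t\<in>{0<..<T}. (q has_vector_derivative D_p H t (q t) (p t)) (at t) \<and>
                   (p has_vector_derivative - D_q H t (q t) (p t)) (at t)) \<and>
    q 0 = q0 \<and> p T = p1"
proof -
  note fd = assms(1) and T = assms(2) and smooth = assms(3) and qp = assms(4)
  have q: "Ck_on 1 {0..T} q" and p: "Ck_on 1 {0..T} p" and q0: "q 0 = q0"
    using qp by (auto simp: C1_curves_def simp del: One_nat_def Ck_on.simps)
  have p_pair: "((\<lambda>t. blinfun_apply (p t) (x t)) has_vector_derivative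
      blinfun_apply (p t) x' + blinfun_apply (velocity T p t) (x t)) (at t within {0..T})"
    if "t \<in> {0..T}" and "(x has_vector_derivative x') (at t within {0..T})" for x x' t
    using bounded_bilinear.has_vector_derivative[OF bounded_bilinear_blinfun_apply
        Ck_on_1_velocity(1)[OF T p that(1)] that(2)] .
  \<comment> \<open>This is the density of the first variation before integration by parts, with the
    derivative still on the variation of \<open>q\<close>.\<close>
  define EL where "EL \<delta>q \<delta>p t = blinfun_apply (p t) (velocity T \<delta>q t)
      - blinfun_apply (D_q H t (q t) (p t)) (\<delta>q t)
      + blinfun_apply (\<delta>p t) (velocity T q t - D_p H t (q t) (p t))" for \<delta>q \<delta>p t
  have dAlembert: "typeII_dAlembert H T q0 p1 q p \<longleftrightarrow>
    (\<forall>\<delta>q \<delta>p. partial_variation T \<delta>q \<delta>p \<longrightarrow>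
      integral {0..T} (EL \<delta>q \<delta>p) = blinfun_apply p1 (\<delta>q T))"
    using has_action_variation_iff[OF fd T smooth qp]
    unfolding typeII_dAlembert_def EL_def by blast
  show ?thesis
  proof (intro iffI conjI ballI q0)
    assume "typeII_dAlembert H T q0 p1 q p"
    then have crit: "integral {0..T} (EL \<delta>q \<delta>p) = blinfun_apply p1 (\<delta>q T)"
      if "partial_variation T \<delta>q \<delta>p" for \<delta>q \<delta>p
      using dAlembert that by blast
    have DH: "continuous_on {0..T} (\<lambda>t. blinfun_apply (D_q H t (q t) (p t)) u +
        blinfun_apply w (D_p H t (q t) (p t)))" for u :: 'q and w :: "'q dual"
    proof -
      have "continuous_on {0..T} (\<lambda>t. (t, (q t, p t), (u, w)))"
        by (intro continuous_intros Ck_on_1_velocity(3)[OF T q] Ck_on_1_velocity(3)[OF T p])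
      from continuous_on_compose2[OF smooth_Hamiltonian_derivative(3)[OF fd smooth] this]
      show ?thesis by auto
    qed
    have D_q: "continuous_on {0..T} (\<lambda>t. blinfun_apply (D_q H t (q t) (p t)) u)" for u
      using DH[of u 0] by simp
    have D_p: "continuous_on {0..T} (\<lambda>t. blinfun_apply w (D_p H t (q t) (p t)))" for w :: "'q dual"
      using DH[of 0 w] by simp
    have "blinfun_apply \<alpha> (velocity T q t - D_p H t (q t) (p t)) = 0" if "t \<in> {0..T}" for \<alpha> :: "'q dual" and t
    proof -
      have "\<forall>t\<in>{0..T}. blinfun_apply \<alpha> (velocity T q t - D_p H t (q t) (p t)) = 0"
      \<comment> \<open>Only the momentum is varied here, so the end point term is zero and the
        lemma is used with \<open>k = 0\<close>.\<close>
      proof (rule fundamental_lemma_free_endpoint(1)[OF T, where k = 0])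
        show "continuous_on {0..T} (\<lambda>t. blinfun_apply \<alpha> (velocity T q t - D_p H t (q t) (p t)))"
          unfolding blinfun.diff_right
          by (intro continuous_intros D_p Ck_on_1_velocity(2)[OF T q])
        fix h :: "real \<Rightarrow> real" assume h: "Ck_on 1 {0..T} h" "h 0 = 0"
        have zero: "Ck_on 1 {0..T} (\<lambda>_. 0 :: 'q)"
          by (rule Ck_on_1_velocityI[OF T has_vector_derivative_const]) simp
        have "partial_variation T (\<lambda>_. 0 :: 'q) (\<lambda>t. h t *\<^sub>R \<alpha>)"
          unfolding partial_variation_def
          using zero Ck_on_1_bounded_linear(1)[OF T bounded_linear_scaleR_left h(1)] by blast
        note var = crit[OF this]
        have "integral {0..T} (\<lambda>t. blinfun_apply \<alpha> (velocity T q t - D_p H t (q t) (p t)) * h t) =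
            integral {0..T} (EL (\<lambda>_. 0) (\<lambda>t. h t *\<^sub>R \<alpha>))"
          by (intro integral_cong)
            (simp add: EL_def velocity_eqI[OF T _ has_vector_derivative_const] blinfun.scaleR_left)
        with var show "integral {0..T}
            (\<lambda>t. blinfun_apply \<alpha> (velocity T q t - D_p H t (q t) (p t)) * h t) = 0 * h T"
          by simp
      qed
      then show ?thesis using that by blast
    qed
    then have q': "velocity T q t = D_p H t (q t) (p t)" if "t \<in> {0..T}" for t
      using dual_separates_points[OF fd, of "velocity T q t - D_p H t (q t) (p t)" 0] that by simp
    \<comment> \<open>Now only the position is varied, in a fixed direction \<open>v\<close>.
      Integration by parts leaves the mismatch between \<open>p1\<close> and \<open>p T\<close> as
      the coefficient of the free end value, and the fundamental lemma removes it together with the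
      integrand.\<close>
    have p_eq: "(\<forall>t\<in>{0..T}. blinfun_apply (- D_q H t (q t) (p t) - velocity T p t) v = 0) \<and>
        blinfun_apply p1 v - blinfun_apply (p T) v = 0" for v
    proof -
      let ?g = "\<lambda>t. blinfun_apply (- D_q H t (q t) (p t) - velocity T p t) v"
      have g: "continuous_on {0..T} ?g"
        unfolding blinfun.diff_left blinfun.minus_left
        by (intro continuous_intros D_q Ck_on_1_velocity(2)[OF T p])
      have "integral {0..T} (\<lambda>t. ?g t * h t) = (blinfun_apply p1 v - blinfun_apply (p T) v) * h T"
        if h: "Ck_on 1 {0..T} h" "h 0 = 0" for h
      proof -
        note hv = Ck_on_1_bounded_linear[OF T bounded_linear_scaleR_left[of v] h(1)]
        have zero: "Ck_on 1 {0..T} (\<lambda>_. 0 :: 'q dual)"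
          by (rule Ck_on_1_velocityI[OF T has_vector_derivative_const]) simp
        have "partial_variation T (\<lambda>t. h t *\<^sub>R v) (\<lambda>_. 0)"
          unfolding partial_variation_def using zero hv(1) h(2) by simp
        note var = crit[OF this]
        have "((\<lambda>t. blinfun_apply (p t) (velocity T h t *\<^sub>R v) +
            blinfun_apply (velocity T p t) (h t *\<^sub>R v)) has_integral
            blinfun_apply (p T) (h T *\<^sub>R v) - blinfun_apply (p 0) (h 0 *\<^sub>R v)) {0..T}"
          using T by (intro fundamental_theorem_of_calculus p_pair
              bounded_linear.has_vector_derivative[OF bounded_linear_scaleR_left]
              Ck_on_1_velocity(1)[OF T h(1)]) auto
        then have parts: "((\<lambda>t. blinfun_apply (p t) (velocity T h t *\<^sub>R v) +
            blinfun_apply (velocity T p t) (h t *\<^sub>R v)) has_integral blinfun_apply (p T) v * h T) {0..T}"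
          by (simp add: h(2) blinfun.scaleR_right mult.commute)
        have "(\<lambda>t. ?g t * h t) integrable_on {0..T}"
          by (intro integrable_continuous_real continuous_on_mult g Ck_on_1_velocity(3)[OF T h(1)])
        \<comment> \<open>Adding the derivative of the pairing of \<open>p\<close> with
          \<open>h v\<close> cancels the term with the velocity of \<open>p\<close> in
          \<open>?g\<close> and recovers the density \<open>EL\<close>.\<close>
        from has_integral_add[OF integrable_integral[OF this] parts]
        have "((\<lambda>t. blinfun_apply (p t) (velocity T h t *\<^sub>R v) -
            blinfun_apply (D_q H t (q t) (p t)) (h t *\<^sub>R v)) has_integral
            integral {0..T} (\<lambda>t. ?g t * h t) + blinfun_apply (p T) v * h T) {0..T}"
          by (simp add: blinfun.diff_left blinfun.minus_left blinfun.scaleR_right algebra_simps)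
        moreover have "EL (\<lambda>t. h t *\<^sub>R v) (\<lambda>_. 0) t = blinfun_apply (p t) (velocity T h t *\<^sub>R v) -
            blinfun_apply (D_q H t (q t) (p t)) (h t *\<^sub>R v)" if "t \<in> {0..T}" for t
          using hv(2)[OF that] by (simp add: EL_def)
        ultimately have "(EL (\<lambda>t. h t *\<^sub>R v) (\<lambda>_. 0) has_integral
            integral {0..T} (\<lambda>t. ?g t * h t) + blinfun_apply (p T) v * h T) {0..T}"
          by (subst has_integral_cong)
        from integral_unique[OF this] var show ?thesis
          by (simp add: blinfun.scaleR_right algebra_simps)
      qed
      from fundamental_lemma_free_endpoint[OF T g this] show ?thesis by blast
    qed
    have "- D_q H t (q t) (p t) - velocity T p t = 0" if "t \<in> {0..T}" for t
      using p_eq that by (intro blinfun_eqI) simp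
    then have p': "velocity T p t = - D_q H t (q t) (p t)" if "t \<in> {0..T}" for t
      using that by fastforce
    show "p T = p1"
      using p_eq by (intro blinfun_eqI) simp
    \<comment> \<open>The equations now hold on the closed interval for one-sided derivatives; at
      interior points these are the two-sided ones.\<close>
    fix t assume t: "t \<in> {0<..<T}"
    then have t': "t \<in> {0..T}" and at: "at t within {0..T} = at t"
      by (auto simp: at_within_Icc_at)
    show "(q has_vector_derivative D_p H t (q t) (p t)) (at t)"
      using Ck_on_1_velocity(1)[OF T q t'] unfolding q'[OF t'] unfolding at .
    show "(p has_vector_derivative - D_q H t (q t) (p t)) (at t)"
      using Ck_on_1_velocity(1)[OF T p t'] unfolding p'[OF t'] unfolding at .
  next
    assume Hamilton: "(\<forall>t\<in>{0<..<T}. (q has_vector_derivative D_p H t (q t) (p t)) (at t) \<and>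
        (p has_vector_derivative - D_q H t (q t) (p t)) (at t)) \<and> q 0 = q0 \<and> p T = p1"
    have "integral {0..T} (EL \<delta>q \<delta>p) = blinfun_apply p1 (\<delta>q T)"
      if "partial_variation T \<delta>q \<delta>p" for \<delta>q \<delta>p
    proof -
      have \<delta>q: "Ck_on 1 {0..T} \<delta>q" "\<delta>q 0 = 0"
        using that by (auto simp: partial_variation_def simp del: One_nat_def Ck_on.simps)
      have "(EL \<delta>q \<delta>p has_integral
          blinfun_apply (p T) (\<delta>q T) - blinfun_apply (p 0) (\<delta>q 0)) {0..T}"
      \<comment> \<open>Hamilton's equations are given on the open interval only, so the end points
        are handled by continuity of the pairing.\<close>
      proof (rule fundamental_theorem_of_calculus_interior)
        show "continuous_on {0..T} (\<lambda>t. blinfun_apply (p t) (\<delta>q t))"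
          by (intro continuous_intros Ck_on_1_velocity(3)[OF T] \<delta>q p)
        fix t assume t: "t \<in> {0<..<T}"
        then have t': "t \<in> {0..T}" and at: "at t within {0..T} = at t"
          by (auto simp: at_within_Icc_at)
        have "velocity T q t = D_p H t (q t) (p t)" "velocity T p t = - D_q H t (q t) (p t)"
          using Hamilton t by (auto simp: at intro!: vector_derivative_at)
        \<comment> \<open>Along a solution the term with \<delta>p vanishes, and replacing
          \<open>- D_q\<close> by the velocity of \<open>p\<close> turns \<open>EL\<close> into the
          product rule for the pairing of \<open>p\<close> and \<delta>q.\<close>
        then show "((\<lambda>t. blinfun_apply (p t) (\<delta>q t)) has_vector_derivative EL \<delta>q \<delta>p t) (at t)"
          using p_pair[OF t' Ck_on_1_velocity(1)[OF T \<delta>q(1) t']]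
          by (simp add: at EL_def blinfun.minus_left)
      qed (use T in simp)
      then show ?thesis
        using Hamilton \<delta>q(2) by (simp add: integral_unique)
    qed
    then show "typeII_dAlembert H T q0 p1 q p"
      using dAlembert by blast
  qed
qed

end
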